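(* For every odd integer $n>15$ there exist two subsets $X,Y$ of the vertex set of the cyclic graph $C_n$ on $n$ vertices which are homometric but not congruent.
   Context: $C_n$ is the cyclic graph with vertex set $\mathbb{Z}/n\mathbb{Z}$ and edges joining $i$ and $i+1$ (the $n$-polygon), with path metric $d$ in which adjacent vertices are at distance $1$. Two subsets $X,Y\subset V(C_n)$ are homometric if they have the same multiset of pairwise distances, equivalently $\sum_{(u,v)\in X^2}t^{d(u,v)}=\sum_{(u,v)\in Y^2}t^{d(u,v)}$. They are congruent if some automorphism of the graph $C_n$ maps $X$ onto $Y$. *)

theory Defs
  imports "Graph_Theory.Graph_Theory" "HOL-Library.Multiset"
begin

text \<open>
  Undirected graphs are rendered as symmetric digraphs. Residues modulo \<open>n\<close> are represented by
  \<open>0, \<dots>, n - 1\<close>. The result is a simple graph only for \<open>n \<ge> 2\<close>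
  (for \<open>n = 1\<close> the vertex \<open>0\<close> would carry a loop).
\<close>

definition cycle_graph :: "nat \<Rightarrow> nat pair_pre_digraph" where
  "cycle_graph n =
     \<lparr> pverts = {0..<n},
       parcs = {(u, v). u < n \<and> v < n \<and> (v = (u + 1) mod n \<or> u = (v + 1) mod n)} \<rparr>"

definition path_dist :: "('a, 'b) pre_digraph \<Rightarrow> 'a \<Rightarrow> 'a \<Rightarrow> ereal" where
  "path_dist G u v = wf_digraph.\<mu> G (\<lambda>_. 1) u v"

text \<open>
  Distances are counted over all ordered pairs, the diagonal included, as in
  \<open>\<Sum>(u, v) \<in> X \<times> X. t ^ d(u, v)\<close>. Only meaningful for finite \<open>X\<close> and \<open>Y\<close>.
\<close>

definition homometric :: "('a, 'b) pre_digraph \<Rightarrow> 'a set \<Rightarrow> 'a set \<Rightarrow> bool" where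
  "homometric G X Y \<longleftrightarrow>
     image_mset (\<lambda>(u, v). path_dist G u v) (mset_set (X \<times> X)) =
     image_mset (\<lambda>(u, v). path_dist G u v) (mset_set (Y \<times> Y))"

text \<open>
  An automorphism is a library isomorphism whose image graph is \<open>G\<close> itself, including the
  incidence maps \<open>tail\<close> and \<open>head\<close>; in the absence of parallel arcs its action on arcs is
  determined by its action on vertices.
\<close>

definition graph_automorphism ::
    "('a, 'b) pre_digraph \<Rightarrow> ('a, 'b, 'a, 'b) digraph_isomorphism \<Rightarrow> bool" where
  "graph_automorphism G f \<longleftrightarrow> pre_digraph.digraph_isomorphism G f \<and> app_iso f G = G"

definition congruent_in :: "('a, 'b) pre_digraph \<Rightarrow> 'a set \<Rightarrow> 'a set \<Rightarrow> bool" where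
  "congruent_in G X Y \<longleftrightarrow> (\<exists>f. graph_automorphism G f \<and> iso_verts f ` X = Y)"

lemma pair_graph_cycle_graph:
  assumes "n \<ge> 2"
  shows "pair_graph (cycle_graph n)"
proof
  show "finite (parcs (cycle_graph n))"
    by (rule finite_subset[of _ "{0..<n} \<times> {0..<n}"]) (auto simp: cycle_graph_def)
  show "symmetric (with_proj (cycle_graph n))"
    by (auto simp: symmetric_def arcs_ends_conv cycle_graph_def sym_def)
  show "fst e \<noteq> snd e" if "e \<in> parcs (cycle_graph n)" for e
    using that assms by (auto simp: cycle_graph_def mod_Suc split: if_splits)
qed (auto simp: cycle_graph_def)

lemma graph_automorphism_iff:
  assumes "pair_wf_digraph G"
  shows "(\<exists>f. graph_automorphism (with_proj G) f \<and> iso_verts f = \<phi>) \<longleftrightarrow>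
    inj_on \<phi> (pverts G) \<and> \<phi> ` pverts G = pverts G \<and>
    (\<lambda>(u, v). (\<phi> u, \<phi> v)) ` parcs G = parcs G" (is "?L \<longleftrightarrow> ?R")
proof
  interpret pair_wf_digraph G by (rule assms)
  assume ?L
  then obtain f where f: "digraph_isomorphism f" "app_iso f (with_proj G) = with_proj G"
    "iso_verts f = \<phi>"
    by (auto simp: graph_automorphism_def)
  have ends: "iso_tail f = fst" "iso_head f = snd"
    "\<phi> ` pverts G = pverts G" "iso_arcs f ` parcs G = parcs G"
    using f(2,3) by (auto simp: app_iso_def with_proj_def)
  have "iso_arcs f a = (\<phi> (fst a), \<phi> (snd a))" if "a \<in> parcs G" for a
    using f(1,3) ends that by (auto simp: digraph_isomorphism_def prod_eq_iff)
  then have "(\<lambda>(u, v). (\<phi> u, \<phi> v)) ` parcs G = iso_arcs f ` parcs G"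
    by (intro image_cong) (auto simp: case_prod_unfold)
  then show ?R using f ends by (auto simp: digraph_isomorphism_def)
next
  interpret pair_wf_digraph G by (rule assms)
  assume R: ?R
  let ?f = "\<lparr> iso_verts = \<phi>, iso_arcs = (\<lambda>(u, v). (\<phi> u, \<phi> v)), iso_head = snd, iso_tail = fst \<rparr>"
  have "inj_on (\<lambda>(u, v). (\<phi> u, \<phi> v)) (parcs G)"
  proof (rule inj_onI)
    fix e e' assume e: "e \<in> parcs G" "e' \<in> parcs G"
      and "(\<lambda>(u, v). (\<phi> u, \<phi> v)) e = (\<lambda>(u, v). (\<phi> u, \<phi> v)) e'"
    then have "\<phi> (fst e) = \<phi> (fst e')" "\<phi> (snd e) = \<phi> (snd e')"
      by (auto simp: case_prod_unfold)
    moreover have "fst e \<in> pverts G" "fst e' \<in> pverts G" "snd e \<in> pverts G" "snd e' \<in> pverts G"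
      using e by (auto intro: arc_fst_in_verts arc_snd_in_verts)
    ultimately show "e = e'" using R by (meson inj_onD prod_eqI)
  qed
  then have "digraph_isomorphism ?f"
    using R wf_digraph by (auto simp: digraph_isomorphism_def)
  moreover have "app_iso ?f (with_proj G) = with_proj G"
    using R by (simp add: app_iso_def with_proj_def)
  ultimately show ?L by (intro exI[of _ ?f]) (auto simp: graph_automorphism_def)
qed

end

theory Submission
  imports Defs
begin

text \<open>
  The integer sets \<open>{0, 1, 2, 5, 7, 9, 12}\<close> and \<open>{0, 1, 5, 7, 8, 10, 12}\<close> have the same multiset of
  differences. Since the distance of two vertices of \<open>C\<^sub>n\<close> depends only on their difference, they
  stay homometric in \<open>C\<^sub>n\<close> for every \<open>n > 12\<close>. The first one contains a vertex with both its
  neighbours. For \<open>n \<ge> 14\<close> the second one does not, hence they are not congruent.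
\<close>

text \<open>A graph homomorphism maps walks to walks of equal length, so the infimum of walk lengths
  cannot grow.\<close>

lemma path_dist_hom_le:
  assumes "pair_wf_digraph G"
    and verts: "\<And>x. x \<in> pverts G \<Longrightarrow> \<phi> x \<in> pverts G"
    and arcs: "\<And>x y. (x, y) \<in> parcs G \<Longrightarrow> (\<phi> x, \<phi> y) \<in> parcs G"
  shows "path_dist (with_proj G) (\<phi> u) (\<phi> v) \<le> path_dist (with_proj G) u v"
proof -
  interpret pair_wf_digraph G by (rule assms(1))
  let ?f = "\<lambda>(x, y). (\<phi> x, \<phi> y)"
  have walk: "awalk (\<phi> u) (map ?f p) (\<phi> v)" if "awalk u p v" for p
    using that
  proof (induction p arbitrary: u)
    case Nil
    then show ?case by (auto simp: awalk_Nil_iff verts)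
  next
    case (Cons e p)
    then show ?case by (cases e) (auto simp: awalk_Cons_iff arcs)
  qed
  have "awalk_cost (\<lambda>_. 1) (map ?f p) = awalk_cost (\<lambda>_. 1) p" for p
    by (induction p) auto
  then show ?thesis
    unfolding path_dist_def \<mu>_def
    by (intro INF_greatest) (metis (mono_tags, lifting) INF_lower mem_Collect_eq walk)
qed

text \<open>The residue of \<open>c - x\<close>, written without truncated subtraction.\<close>

definition reflection :: "nat \<Rightarrow> nat \<Rightarrow> nat \<Rightarrow> nat" where
  "reflection n c x = (if x \<le> c then c - x else c + n - x)"

lemma reflection_less: "c < n \<Longrightarrow> x < n \<Longrightarrow> reflection n c x < n"
  by (auto simp: reflection_def)

lemma reflection_reflection: "c < n \<Longrightarrow> x < n \<Longrightarrow> reflection n c (reflection n c x) = x"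
  by (auto simp: reflection_def)

lemma cycle_graph_arc_iff:
  "(x, y) \<in> parcs (cycle_graph n) \<longleftrightarrow>
    x < n \<and> y < n \<and> (y = x + 1 \<or> x = y + 1 \<or> x + 1 = n \<and> y = 0 \<or> y + 1 = n \<and> x = 0)"
proof (cases "x < n \<and> y < n")
  case True
  then have "(x + 1) mod n = (if x + 1 = n then 0 else x + 1)"
    "(y + 1) mod n = (if y + 1 = n then 0 else y + 1)"
    by simp_all
  with True show ?thesis by (auto simp: cycle_graph_def)
qed (auto simp: cycle_graph_def)

lemma reflection_arc:
  assumes "c < n" "(x, y) \<in> parcs (cycle_graph n)"
  shows "(reflection n c x, reflection n c y) \<in> parcs (cycle_graph n)"
proof -
  have "x < n" "y < n" and
    arc: "y = x + 1 \<or> x = y + 1 \<or> x + 1 = n \<and> y = 0 \<or> y + 1 = n \<and> x = 0"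
    using assms(2) by (simp_all add: cycle_graph_arc_iff)
  from arc show ?thesis
    unfolding cycle_graph_arc_iff using reflection_less[OF assms(1)] \<open>x < n\<close> \<open>y < n\<close> assms(1)
    \<comment> \<open>The delicate arcs have ends in different branches of
      \<open>reflection\<close>: for \<open>c + 1 < n\<close>, the ends \<open>c\<close> and
      \<open>c + 1\<close> go to \<open>0\<close> and \<open>n - 1\<close>, which are again
      adjacent.\<close>
    by (elim disjE conjE) (cases "x \<le> c"; cases "y \<le> c"; simp add: reflection_def; linarith)+
qed

text \<open>Reflections are involutive homomorphisms: the inequality for a pair and the one for its
  image combine to an equality.\<close>

lemma path_dist_reflection:
  assumes "2 \<le> n" "c < n" "u < n" "v < n"
  shows "path_dist (with_proj (cycle_graph n)) (reflection n c u) (reflection n c v) =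
    path_dist (with_proj (cycle_graph n)) u v"
proof -
  interpret pair_graph "cycle_graph n" by (rule pair_graph_cycle_graph[OF assms(1)])
  have "path_dist (with_proj (cycle_graph n)) (reflection n c x) (reflection n c y) \<le>
      path_dist (with_proj (cycle_graph n)) x y" for x y
    using assms(2)
    by (intro path_dist_hom_le pair_wf_digraph_axioms reflection_arc)
      (auto simp: cycle_graph_def reflection_less)
  from this[of u v] this[of "reflection n c u" "reflection n c v"] show ?thesis
    using assms by (simp add: reflection_reflection)
qed

text \<open>Reflections alone suffice: the one with \<open>c = v\<close> moves \<open>v\<close> to
  \<open>0\<close> and \<open>u\<close> to \<open>v - u\<close>, and the one with
  \<open>c = v - u\<close> swaps \<open>0\<close> and \<open>v - u\<close>.\<close>

lemma path_dist_diff: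
  assumes "2 \<le> n" "v < n" "u \<le> v"
  shows "path_dist (with_proj (cycle_graph n)) v u = path_dist (with_proj (cycle_graph n)) 0 (v - u)"
    and "path_dist (with_proj (cycle_graph n)) u v = path_dist (with_proj (cycle_graph n)) 0 (v - u)"
proof -
  show vu: "path_dist (with_proj (cycle_graph n)) v u =
      path_dist (with_proj (cycle_graph n)) 0 (v - u)"
    using path_dist_reflection[of n v v u] assms by (simp add: reflection_def)
  have "path_dist (with_proj (cycle_graph n)) u v = path_dist (with_proj (cycle_graph n)) (v - u) 0"
    using path_dist_reflection[of n v u v] assms by (simp add: reflection_def)
  then show "path_dist (with_proj (cycle_graph n)) u v =
      path_dist (with_proj (cycle_graph n)) 0 (v - u)"
    using path_dist_reflection[of n "v - u" 0 "v - u"] assms by (simp add: reflection_def)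
qed

text \<open>With truncated subtraction, \<open>(u - v) + (v - u)\<close> is the absolute difference of \<open>u\<close> and \<open>v\<close>.\<close>

lemma path_dist_abs_diff:
  assumes "2 \<le> n" "u < n" "v < n"
  shows "path_dist (with_proj (cycle_graph n)) u v =
    path_dist (with_proj (cycle_graph n)) 0 ((u - v) + (v - u))"
  using assms path_dist_diff[of n u v] path_dist_diff[of n v u] by (cases "u \<le> v") auto

lemma homometric_cycle_graphI:
  assumes "2 \<le> n" and X: "X \<subseteq> {0..<n}" and Y: "Y \<subseteq> {0..<n}"
    and eq: "image_mset (\<lambda>(u, v). (u - v) + (v - u)) (mset_set (X \<times> X)) =
      image_mset (\<lambda>(u, v). (u - v) + (v - u)) (mset_set (Y \<times> Y))"
  shows "homometric (with_proj (cycle_graph n)) X Y"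
proof -
  let ?d = "path_dist (with_proj (cycle_graph n))"
  have "image_mset (\<lambda>(u, v). ?d u v) (mset_set (Z \<times> Z)) =
      image_mset (?d 0) (image_mset (\<lambda>(u, v). (u - v) + (v - u)) (mset_set (Z \<times> Z)))"
    if "Z \<subseteq> {0..<n}" for Z
  proof -
    have "finite (Z \<times> Z)" using that by (auto intro: finite_subset)
    moreover have "?d u v = ?d 0 ((u - v) + (v - u))" if "u \<in> Z" "v \<in> Z" for u v
      using that \<open>Z \<subseteq> {0..<n}\<close> assms(1) by (intro path_dist_abs_diff) auto
    ultimately show ?thesis
      unfolding multiset.map_comp by (intro image_mset_cong) auto
  qed
  from this[OF X] this[OF Y] eq show ?thesis by (simp only: homometric_def)
qed

text \<open>Passing to lists makes the multiset of differences computable by evaluation.\<close>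

lemma image_mset_set_product:
  assumes "distinct xs"
  shows "image_mset f (mset_set (set xs \<times> set xs)) = mset (map f (List.product xs xs))"
  by (metis assms distinct_product mset_map mset_set_set set_product)

text \<open>The generating polynomials of the two sets are \<open>P(t) Q(t)\<close> and
  \<open>P(t) t^5 Q(1/t)\<close> with \<open>P = 1 + t + t^2 + t^3 + t^4 + t^5 + t^7\<close> and
  \<open>Q = 1 - t^3 + t^5\<close>. Reversing one factor preserves the product of a polynomial
  \<open>A(t)\<close> with \<open>A(1/t)\<close>, which counts differences.\<close>

lemma homometric_cycle_graph:
  assumes "12 < n"
  shows "homometric (with_proj (cycle_graph n)) {0, 1, 2, 5, 7, 9, 12} {0, 1, 5, 7, 8, 10, 12}"
proof -
  let ?xs = "[0, 1, 2, 5, 7, 9, 12] :: nat list" and ?ys = "[0, 1, 5, 7, 8, 10, 12] :: nat list"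
  let ?f = "\<lambda>(u, v). (u - v) + (v - u) :: nat"
  have "distinct ?xs" "distinct ?ys" by simp_all
  moreover have "mset (map ?f (List.product ?xs ?xs)) = mset (map ?f (List.product ?ys ?ys))"
    by code_simp
  ultimately have eq: "image_mset ?f (mset_set (set ?xs \<times> set ?xs)) =
      image_mset ?f (mset_set (set ?ys \<times> set ?ys))"
    by (simp only: image_mset_set_product)
  have "homometric (with_proj (cycle_graph n)) (set ?xs) (set ?ys)"
    by (rule homometric_cycle_graphI[OF _ _ _ eq]) (use assms in simp_all)
  then show ?thesis by (simp only: list.set)
qed

lemma not_congruent_cycle_graph:
  assumes "14 \<le> n"
  shows "\<not> congruent_in (with_proj (cycle_graph n)) {0, 1, 2, 5, 7, 9, 12} {0, 1, 5, 7, 8, 10, 12}"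
    (is "\<not> congruent_in _ ?X ?Y")
proof
  interpret pair_graph "cycle_graph n" using assms by (intro pair_graph_cycle_graph) simp
  assume "congruent_in (with_proj (cycle_graph n)) ?X ?Y"
  then obtain f where f: "graph_automorphism (with_proj (cycle_graph n)) f"
    and image: "iso_verts f ` ?X = ?Y"
    unfolding congruent_in_def by (elim exE conjE)
  define \<phi> where "\<phi> = iso_verts f"
  have inj: "inj_on \<phi> (pverts (cycle_graph n))"
    and arcs: "(\<lambda>(u, v). (\<phi> u, \<phi> v)) ` parcs (cycle_graph n) = parcs (cycle_graph n)"
    using graph_automorphism_iff[OF pair_wf_digraph_axioms, of \<phi>] f \<phi>_def by blast+
  have arc: "(\<phi> u, \<phi> v) \<in> parcs (cycle_graph n)" if "(u, v) \<in> parcs (cycle_graph n)" for u v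
    using imageI[OF that, of "\<lambda>(u, v). (\<phi> u, \<phi> v)"] unfolding arcs by simp
  have Y: "\<phi> x \<in> ?Y" if "x \<in> ?X" for x
    using imageI[OF that, of \<phi>] unfolding \<phi>_def image .
  have arc_Y: "(u, v) \<in> {(0, 1), (1, 0), (7, 8), (8, 7)}"
    if "(u, v) \<in> parcs (cycle_graph n)" "u \<in> ?Y" "v \<in> ?Y" for u v
  proof -
    \<comment> \<open>This excludes the arcs through \<open>n - 1\<close> and \<open>0\<close>; for
      \<open>n = 13\<close> the elements \<open>12\<close> and \<open>0\<close> would be
      adjacent.\<close>
    have "u + 1 < n" "v + 1 < n" using that(2,3) assms by auto
    then have "v = u + 1 \<or> u = v + 1" using that(1) by (simp add: cycle_graph_def)
    moreover have pred: "x = 0 \<or> x = 7" if "x \<in> ?Y" "x + 1 \<in> ?Y" for x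
      using that by (elim insertE emptyE) simp_all
    ultimately show ?thesis
    proof (elim disjE)
      assume 1: "v = u + 1"
      then have "u = 0 \<or> u = 7" using pred[of u] that(2,3) by (simp only:)
      with 1 show ?thesis by auto
    next
      assume 2: "u = v + 1"
      then have "v = 0 \<or> v = 7" using pred[of v] that(2,3) by (simp only:)
      with 2 show ?thesis by auto
    qed
  qed
  have "(\<phi> 0, \<phi> 1) \<in> {(0, 1), (1, 0), (7, 8), (8, 7)}"
    by (intro arc_Y arc Y) (use assms in \<open>simp_all add: cycle_graph_def\<close>)
  moreover have "(\<phi> 1, \<phi> 2) \<in> {(0, 1), (1, 0), (7, 8), (8, 7)}"
    by (intro arc_Y arc Y) (use assms in \<open>simp_all add: cycle_graph_def\<close>)
  moreover have "\<phi> 0 \<noteq> \<phi> 2"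
    using inj_on_contraD[OF inj, of 0 2] assms by (simp add: cycle_graph_def)
  \<comment> \<open>The four arcs form two disjoint edges, so \<open>\<phi> 1\<close> has a single
    neighbour among them and \<open>\<phi> 0 = \<phi> 2\<close>.\<close>
  ultimately show False by auto
qed

theorem mainTheorem9:
  fixes n :: nat
  assumes "odd n" and "n > 15"
  shows "\<exists>X Y. X \<subseteq> verts (with_proj (cycle_graph n)) \<and> Y \<subseteq> verts (with_proj (cycle_graph n)) \<and>
    homometric (with_proj (cycle_graph n)) X Y \<and>
    \<not> congruent_in (with_proj (cycle_graph n)) X Y"
proof (intro exI conjI)
  show "homometric (with_proj (cycle_graph n)) {0, 1, 2, 5, 7, 9, 12} {0, 1, 5, 7, 8, 10, 12}"
    using assms by (intro homometric_cycle_graph) simp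
  show "\<not> congruent_in (with_proj (cycle_graph n)) {0, 1, 2, 5, 7, 9, 12} {0, 1, 5, 7, 8, 10, 12}"
    using assms by (intro not_congruent_cycle_graph) simp
qed (use assms in \<open>auto simp: cycle_graph_def\<close>)

end
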